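(* For each Platonic solid except the tetrahedron (i.e. for $n=6,8,12,20$), with circumradius $R>0$, and for any point $M$ of the space, $$S_{[n]}^{(6)}=S_{[n]}^{(2)}\left(\left(S_{[n]}^{(2)}+2R^2\right)^2-8R^4\right),$$ $$S_{[n]}^{(6)}=S_{[n]}^{(2)}\left(3S_{[n]}^{(4)}-2\left(S_{[n]}^{(2)}\right)^2\right).$$
   Context: The Platonic solid with $n$ vertices is the regular octahedron ($n=6$), cube ($n=8$), regular icosahedron ($n=12$) or regular dodecahedron ($n=20$). For such a solid in Euclidean $3$-space with vertices $A_1,\dots,A_n$ and a point $M$ of the space, put $d_i=|MA_i|$ and $S_{[n]}^{(2m)}=\frac1n\sum_{i=1}^n d_i^{2m}$. *)

theory Defs
  imports "HOL-Analysis.Analysis"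
begin

definition golden_ratio :: real where
  "golden_ratio = (1 + sqrt 5) / 2"

definition tetrahedron_points :: "(real^3) set" where
  "tetrahedron_points =
     {vector [1, 1, 1], vector [1, -1, -1], vector [-1, 1, -1], vector [-1, -1, 1]}"

definition octahedron_points :: "(real^3) set" where
  "octahedron_points =
     {vector [s, 0, 0] | s. s \<in> {-1, 1}} \<union>
     {vector [0, s, 0] | s. s \<in> {-1, 1}} \<union>
     {vector [0, 0, s] | s. s \<in> {-1, 1}}"

definition cube_points :: "(real^3) set" where
  "cube_points = {vector [s, t, u] | s t u. s \<in> {-1, 1} \<and> t \<in> {-1, 1} \<and> u \<in> {-1, 1}}"

definition icosahedron_points :: "(real^3) set" where
  "icosahedron_points =
     {vector [0, s, t * golden_ratio] | s t. s \<in> {-1, 1} \<and> t \<in> {-1, 1}} \<union>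
     {vector [s, t * golden_ratio, 0] | s t. s \<in> {-1, 1} \<and> t \<in> {-1, 1}} \<union>
     {vector [t * golden_ratio, 0, s] | s t. s \<in> {-1, 1} \<and> t \<in> {-1, 1}}"

definition dodecahedron_points :: "(real^3) set" where
  "dodecahedron_points =
     cube_points \<union>
     {vector [0, s / golden_ratio, t * golden_ratio] | s t. s \<in> {-1, 1} \<and> t \<in> {-1, 1}} \<union>
     {vector [s / golden_ratio, t * golden_ratio, 0] | s t. s \<in> {-1, 1} \<and> t \<in> {-1, 1}} \<union>
     {vector [t * golden_ratio, 0, s / golden_ratio] | s t. s \<in> {-1, 1} \<and> t \<in> {-1, 1}}"

definition similarity :: "('a::metric_space \<Rightarrow> 'a) \<Rightarrow> bool" where
  "similarity f \<longleftrightarrow> (\<exists>r>0. \<forall>x y. dist (f x) (f y) = r * dist x y)"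

definition similar_sets :: "'a::metric_space set \<Rightarrow> 'a set \<Rightarrow> bool" where
  "similar_sets P Q \<longleftrightarrow> (\<exists>f. similarity f \<and> P = f ` Q)"

text \<open>
  The solids of each of the five kinds are determined up to similarity; each kind is represented
  by the convex hull of its usual Cartesian vertex set, and a solid of that kind is any similar
  copy, in arbitrary position and of arbitrary size.
\<close>

definition regular_tetrahedron :: "(real^3) set \<Rightarrow> bool" where
  "regular_tetrahedron P \<longleftrightarrow> similar_sets P (convex hull tetrahedron_points)"

definition regular_octahedron :: "(real^3) set \<Rightarrow> bool" where
  "regular_octahedron P \<longleftrightarrow> similar_sets P (convex hull octahedron_points)"

definition cube :: "(real^3) set \<Rightarrow> bool" where
  "cube P \<longleftrightarrow> similar_sets P (convex hull cube_points)"

definition regular_icosahedron :: "(real^3) set \<Rightarrow> bool" where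
  "regular_icosahedron P \<longleftrightarrow> similar_sets P (convex hull icosahedron_points)"

definition regular_dodecahedron :: "(real^3) set \<Rightarrow> bool" where
  "regular_dodecahedron P \<longleftrightarrow> similar_sets P (convex hull dodecahedron_points)"

definition platonic_solid :: "(real^3) set \<Rightarrow> bool" where
  "platonic_solid P \<longleftrightarrow>
     regular_tetrahedron P \<or> regular_octahedron P \<or> cube P \<or>
     regular_icosahedron P \<or> regular_dodecahedron P"

definition vertices :: "'a::real_vector set \<Rightarrow> 'a set" where
  "vertices P = {v. v extreme_point_of P}"

text \<open>
  The centre of a sphere through all vertices is unique for a three-dimensional solid, hence so
  is its radius.
\<close>

definition has_circumradius :: "'a::real_normed_vector set \<Rightarrow> real \<Rightarrow> bool" where
  "has_circumradius P R \<longleftrightarrow> (\<exists>c. \<forall>v\<in>vertices P. dist c v = R)"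

text \<open>
  The superscript of \<open>S\<close> is the exponent of the distances, so the mean of the \<open>2m\<close>-th powers
  is \<open>S n A (2 * m) M\<close>.
\<close>

definition S :: "nat \<Rightarrow> (nat \<Rightarrow> 'a::metric_space) \<Rightarrow> nat \<Rightarrow> 'a \<Rightarrow> real" where
  "S n A k M = (1 / real n) * (\<Sum>i=1..n. dist M (A i) ^ k)"

end

theory Submission
  imports Defs
begin

text \<open>
  Let \<open>c\<close> be the centre of the solid and put \<open>w = v - c\<close> for a vertex \<open>v\<close> and \<open>m = M - c\<close>. Then
  \<open>dist M v ^ 2 = X - 2 * (m \<bullet> w)\<close> with \<open>X = norm m ^ 2 + R ^ 2\<close>, so the averages of the powers of
  the distances are governed by those of \<open>m \<bullet> w\<close>, \<open>(m \<bullet> w) ^ 2\<close> and \<open>(m \<bullet> w) ^ 3\<close>. Central symmetry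
  kills the odd ones. Reflections in the coordinate planes and cyclic permutations of the coordinates,
  which preserve each of the four vertex sets, force the quadratic one to be
  \<open>R ^ 2 * norm m ^ 2 / 3\<close>. Hence the averages are \<open>X\<close>, \<open>X ^ 2 + 4 / 3 * R ^ 2 * norm m ^ 2\<close> and
  \<open>X ^ 3 + 4 * X * R ^ 2 * norm m ^ 2\<close>, where \<open>norm m ^ 2 = X - R ^ 2\<close>.
\<close>

section \<open>Moments of centrally symmetric point sets on a sphere\<close>

text \<open>In a Euclidean space, for nonempty \<open>V\<close> and positive \<rho>, this is an
  antipodal spherical 3-design with centre \<open>c\<close>. The factor \<open>k\<close> is left
  open because a trace computation determines it, so a concrete set only has to be shown to have
  some such factor.\<close>

definition isotropic_about :: "'a::real_inner \<Rightarrow> 'a set \<Rightarrow> real \<Rightarrow> bool" where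
  "isotropic_about c V \<rho> \<longleftrightarrow>
     finite V \<and> (\<forall>v\<in>V. 2 *\<^sub>R c - v \<in> V) \<and> (\<forall>v\<in>V. dist c v = \<rho>) \<and>
     (\<exists>k. \<forall>x. (\<Sum>v\<in>V. (x \<bullet> (v - c))\<^sup>2) = k * (x \<bullet> x))"

text \<open>Taking the trace of the quadratic form finds \<open>k\<close>: summed over an
  orthonormal basis, one side becomes \<open>k * DIM('a)\<close>, the other the sum of the squared
  distances to \<open>c\<close>, each equal to \<open>\<rho>\<^sup>2\<close>.\<close>

lemma isotropic_sum_squares:
  fixes V :: "'a::euclidean_space set"
  assumes "isotropic_about c V \<rho>"
  shows "(\<Sum>v\<in>V. (x \<bullet> (v - c))\<^sup>2) = real (card V) * \<rho>\<^sup>2 / DIM('a) * (x \<bullet> x)"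
proof -
  obtain k where k: "\<And>x. (\<Sum>v\<in>V. (x \<bullet> (v - c))\<^sup>2) = k * (x \<bullet> x)"
    and dist: "\<And>v. v \<in> V \<Longrightarrow> dist c v = \<rho>"
    using assms unfolding isotropic_about_def by metis
  have "k * DIM('a) = (\<Sum>b\<in>Basis. \<Sum>v\<in>V. (b \<bullet> (v - c))\<^sup>2)"
    by (simp add: k inner_same_Basis)
  also have "\<dots> = (\<Sum>v\<in>V. \<Sum>b\<in>Basis. (b \<bullet> (v - c))\<^sup>2)"
    by (rule sum.swap)
  also have "\<dots> = (\<Sum>v\<in>V. (dist c v)\<^sup>2)"
  proof (rule sum.cong)
    fix v
    show "(\<Sum>b\<in>Basis. (b \<bullet> (v - c))\<^sup>2) = (dist c v)\<^sup>2"
      using euclidean_inner[of "v - c" "v - c"]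
      by (simp add: dist_norm norm_minus_commute[of c] power2_norm_eq_inner)
        (simp add: power2_eq_square inner_commute)
  qed simp
  also have "\<dots> = real (card V) * \<rho>\<^sup>2"
    by (simp add: dist)
  finally have "k = real (card V) * \<rho>\<^sup>2 / DIM('a)"
    by (simp add: field_simps)
  then show ?thesis
    using k by simp
qed

text \<open>The point reflection in \<open>c\<close> permutes \<open>V\<close> and negates every odd
  power, so the sum equals its own negative.\<close>

lemma isotropic_sum_odd:
  fixes V :: "'a::real_inner set"
  assumes "isotropic_about c V \<rho>" and "odd k"
  shows "(\<Sum>v\<in>V. (x \<bullet> (v - c)) ^ k) = 0"
proof -
  have sym: "\<And>v. v \<in> V \<Longrightarrow> 2 *\<^sub>R c - v \<in> V"
    using assms unfolding isotropic_about_def by blast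
  have "(\<Sum>v\<in>V. (x \<bullet> (v - c)) ^ k) = (\<Sum>v\<in>V. (x \<bullet> ((2 *\<^sub>R c - v) - c)) ^ k)"
    by (rule sum.reindex_bij_witness[where i = "\<lambda>v. 2 *\<^sub>R c - v" and j = "\<lambda>v. 2 *\<^sub>R c - v"])
      (auto simp: sym)
  also have "\<dots> = (\<Sum>v\<in>V. - ((x \<bullet> (v - c)) ^ k))"
  proof (rule sum.cong)
    fix v
    have "x \<bullet> ((2 *\<^sub>R c - v) - c) = - (x \<bullet> (v - c))"
      by (simp add: inner_simps)
    then show "(x \<bullet> ((2 *\<^sub>R c - v) - c)) ^ k = - ((x \<bullet> (v - c)) ^ k)"
      using \<open>odd k\<close> by simp
  qed simp
  finally show ?thesis
    by (simp add: sum_negf)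
qed

text \<open>A point equidistant from the antipodes \<open>v\<close> and
  \<open>2 *\<^sub>R c - v\<close> has \<open>a - c\<close> orthogonal to \<open>v - c\<close>. The
  quadratic form therefore vanishes at \<open>a - c\<close>, yet it is a positive multiple of the
  squared norm.\<close>

lemma isotropic_circumcentre_unique:
  fixes V :: "'a::euclidean_space set"
  assumes iso: "isotropic_about c V \<rho>" and "V \<noteq> {}" and "\<rho> > 0"
    and a: "\<And>v. v \<in> V \<Longrightarrow> dist a v = R"
  shows "a = c"
proof -
  have "(a - c) \<bullet> (v - c) = 0" if "v \<in> V" for v
  proof -
    have "2 *\<^sub>R c - v \<in> V"
      using iso that unfolding isotropic_about_def by blast
    then have "norm ((a - c) - (v - c)) = norm ((a - c) + (v - c))"
      using a[OF that] a[of "2 *\<^sub>R c - v"] by (simp add: dist_norm algebra_simps scaleR_2)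
    then show ?thesis
      by (simp add: norm_eq inner_simps inner_commute)
  qed
  then have "(\<Sum>v\<in>V. ((a - c) \<bullet> (v - c))\<^sup>2) = 0"
    by simp
  moreover have "card V > 0"
    using iso \<open>V \<noteq> {}\<close> by (simp add: isotropic_about_def card_gt_0_iff)
  ultimately show ?thesis
    using isotropic_sum_squares[OF iso, of "a - c"] \<open>\<rho> > 0\<close> by simp
qed

text \<open>Writing \<open>x = g y\<close> cancels \<open>g\<close> from the inner products, so the
  quadratic form only picks up the factor \<open>r\<^sup>2\<close>.\<close>

lemma isotropic_similarity_image:
  fixes r :: real
  assumes iso: "isotropic_about c V \<rho>" and g: "orthogonal_transformation (g :: 'a::euclidean_space \<Rightarrow> 'a)"
    and "r > 0"
  shows "isotropic_about (a + r *\<^sub>R g c) ((\<lambda>x. a + r *\<^sub>R g x) ` V) (r * \<rho>)"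
proof -
  let ?f = "\<lambda>x. a + r *\<^sub>R g x"
  have lin: "linear g"
    using g by (rule orthogonal_transformation_linear)
  have inj: "inj_on ?f V"
    using orthogonal_transformation_inj[OF g] \<open>r > 0\<close> by (auto simp: inj_on_def)
  obtain k where k: "\<And>x. (\<Sum>v\<in>V. (x \<bullet> (v - c))\<^sup>2) = k * (x \<bullet> x)"
    using iso unfolding isotropic_about_def by blast
  have "(\<Sum>v\<in>?f ` V. (x \<bullet> (v - ?f c))\<^sup>2) = r\<^sup>2 * k * (x \<bullet> x)" for x
  proof -
    obtain y where y: "x = g y"
      using orthogonal_transformation_surj[OF g] by (metis surjD)
    have "x \<bullet> (?f v - ?f c) = r * (y \<bullet> (v - c))" for v
    proof -
      have "?f v - ?f c = r *\<^sub>R g (v - c)"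
        by (simp add: linear_diff[OF lin] scaleR_diff_right)
      then show ?thesis
        using g by (simp add: y orthogonal_transformation_def)
    qed
    moreover have "x \<bullet> x = y \<bullet> y"
      using g by (simp add: y orthogonal_transformation_def)
    ultimately show ?thesis
      using k[of y] by (simp add: sum.reindex[OF inj] power_mult_distrib flip: sum_distrib_left)
  qed
  moreover have "2 *\<^sub>R ?f c - ?f v \<in> ?f ` V" if "v \<in> V" for v
  proof
    show "2 *\<^sub>R ?f c - ?f v = ?f (2 *\<^sub>R c - v)"
      by (simp add: linear_diff[OF lin] linear_scale[OF lin] scaleR_diff_right scaleR_add_right)
        (simp add: scaleR_2)
    show "2 *\<^sub>R c - v \<in> V"
      using iso that unfolding isotropic_about_def by blast
  qed
  moreover have "dist (?f c) (?f v) = r * \<rho>" if "v \<in> V" for v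
  proof -
    have "dist (?f c) (?f v) = r * dist (g c) (g v)"
      using \<open>r > 0\<close> by (simp add: dist_norm flip: scaleR_diff_right)
    also have "\<dots> = r * \<rho>"
      using g iso that by (simp add: orthogonal_transformation_isometry isotropic_about_def)
    finally show ?thesis .
  qed
  ultimately show ?thesis
    using iso unfolding isotropic_about_def by blast
qed

section \<open>Similarities, convex hulls and their vertices\<close>

text \<open>Subtracting \<open>f 0\<close> and dividing by the ratio leaves an isometry fixing the
  origin, and such a map is linear and orthogonal.\<close>

lemma similarity_decompose:
  fixes f :: "'a::real_inner \<Rightarrow> 'a"
  assumes "similarity f"
  obtains a r g where "r > 0" "orthogonal_transformation g" "f = (\<lambda>x. a + r *\<^sub>R g x)"
proof -
  obtain r where "r > 0" and r: "\<And>x y. dist (f x) (f y) = r * dist x y"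
    using assms unfolding similarity_def by blast
  define g where "g = (\<lambda>x. (1 / r) *\<^sub>R (f x - f 0))"
  have "dist (g x) (g y) = dist x y" for x y
    using r[of x y] \<open>r > 0\<close> by (simp add: g_def dist_norm flip: scaleR_diff_right)
  then have "orthogonal_transformation g"
    by (simp add: orthogonal_transformation_isometry) (simp add: g_def)
  moreover have "f = (\<lambda>x. f 0 + r *\<^sub>R g x)"
    using \<open>r > 0\<close> by (simp add: g_def)
  ultimately show ?thesis
    using \<open>r > 0\<close> that by blast
qed

lemma vertices_convex_hull_subset: "vertices (convex hull V) \<subseteq> V"
  by (simp add: vertices_def extreme_points_of_convex_hull)

text \<open>The tangent plane of the sphere at \<open>v\<close> supports the hull and meets it only
  in \<open>v\<close>.\<close>

lemma vertices_convex_hull_sphere: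
  fixes V :: "'a::euclidean_space set"
  assumes "\<And>v. v \<in> V \<Longrightarrow> dist c v = \<rho>"
  shows "vertices (convex hull V) = V"
proof
  have sub: "convex hull V \<subseteq> cball c \<rho>"
    using assms by (intro hull_minimal) auto
  show "V \<subseteq> vertices (convex hull V)"
  proof
    fix v assume v: "v \<in> V"
    have norm_v: "(v - c) \<bullet> (v - c) = \<rho>\<^sup>2"
      using assms[OF v] by (simp add: dist_norm norm_minus_commute flip: power2_norm_eq_inner)
    \<comment> \<open>Expand \<open>(x - c) \<bullet> (x - c) \<le> \<rho>\<^sup>2\<close> with
      \<open>x - c = (x - v) + (v - c)\<close>. The bound yields both that \<open>v\<close>
      maximises the functional \<open>v - c\<close> on the hull and that it is the only
      maximiser.\<close>
    have gap: "(x - v) \<bullet> (x - v) \<le> 2 * ((v - c) \<bullet> v - (v - c) \<bullet> x)" if "x \<in> convex hull V" for x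
    proof -
      have "norm (x - c) \<le> \<rho>"
        using sub that by (auto simp: dist_norm norm_minus_commute)
      then have "(x - c) \<bullet> (x - c) \<le> \<rho>\<^sup>2"
        by (simp add: norm_le_square)
      then show ?thesis
        using norm_v by (simp add: inner_simps inner_commute algebra_simps)
    qed
    have "v extreme_point_of (convex hull V)"
    proof (rule extreme_point_of_Int_supporting_hyperplane_le)
      show "convex hull V \<inter> {x. (v - c) \<bullet> x = (v - c) \<bullet> v} = {v}"
      proof (intro equalityI subsetI)
        fix x assume "x \<in> convex hull V \<inter> {x. (v - c) \<bullet> x = (v - c) \<bullet> v}"
        then have "(x - v) \<bullet> (x - v) \<le> 0"
          using gap[of x] by simp
        then have "(x - v) \<bullet> (x - v) = 0"
          by (rule antisym) simp
        then show "x \<in> {v}"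
          by simp
      qed (use v in \<open>simp add: hull_inc\<close>)
      show "(v - c) \<bullet> x \<le> (v - c) \<bullet> v" if "x \<in> convex hull V" for x
        using order_trans[OF inner_ge_zero gap[OF that]] by simp
    qed
    then show "v \<in> vertices (convex hull V)"
      by (simp add: vertices_def)
  qed
qed (rule vertices_convex_hull_subset)

text \<open>A similarity is affine, so it commutes with convex hulls; its linear part and its
  translation are treated separately.\<close>

lemma similar_convex_hull:
  fixes P :: "'a::euclidean_space set"
  assumes "similar_sets P (convex hull Q)"
  obtains a r g where "r > 0" "orthogonal_transformation g"
    "P = convex hull ((\<lambda>x. a + r *\<^sub>R g x) ` Q)"
proof -
  obtain f where f: "similarity f" and P: "P = f ` (convex hull Q)"
    using assms unfolding similar_sets_def by blast
  obtain a r g where rg: "r > 0" "orthogonal_transformation g" and f_eq: "f = (\<lambda>x. a + r *\<^sub>R g x)"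
    using similarity_decompose[OF f] .
  have lin: "linear (\<lambda>x. r *\<^sub>R g x)"
    using rg by (intro linear_compose_scale_right orthogonal_transformation_linear)
  have "f ` T = (\<lambda>x. a + x) ` (\<lambda>x. r *\<^sub>R g x) ` T" for T
    by (simp add: f_eq image_image)
  then have "P = convex hull (f ` Q)"
    by (simp add: P convex_hull_translation convex_hull_linear_image[OF lin])
  then show ?thesis
    using rg f_eq that by blast
qed

lemma isotropic_vertices_of_similar:
  fixes P :: "'a::euclidean_space set"
  assumes "similar_sets P (convex hull Q)" and iso: "isotropic_about c Q \<rho>" and "\<rho> > 0"
  obtains a \<rho>' where "isotropic_about a (vertices P) \<rho>'" "\<rho>' > 0"
proof -
  obtain a r g where rg: "r > 0" "orthogonal_transformation g"
    and P: "P = convex hull ((\<lambda>x. a + r *\<^sub>R g x) ` Q)"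
    using similar_convex_hull[OF assms(1)] .
  have im: "isotropic_about (a + r *\<^sub>R g c) ((\<lambda>x. a + r *\<^sub>R g x) ` Q) (r * \<rho>)"
    using isotropic_similarity_image[OF iso rg(2,1)] .
  \<comment> \<open>The image points again lie on a sphere, so each of them is a vertex of their
    hull.\<close>
  have "vertices P = (\<lambda>x. a + r *\<^sub>R g x) ` Q"
    unfolding P
  proof (rule vertices_convex_hull_sphere)
    show "dist (a + r *\<^sub>R g c) v = r * \<rho>" if "v \<in> (\<lambda>x. a + r *\<^sub>R g x) ` Q" for v
      using im that unfolding isotropic_about_def by blast
  qed
  then show ?thesis
    using im rg \<open>\<rho> > 0\<close> that by simp
qed

text \<open>In the second moment matrix the reflection kills one off-diagonal entry and the cyclic
  shift carries this to the other two. The shift also makes the diagonal entries equal, so the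
  matrix is scalar.\<close>

lemma isotropic_if_coordinate_symmetric:
  fixes Q :: "(real^3) set"
  assumes fin: "finite Q"
    and refl: "\<And>v. v \<in> Q \<Longrightarrow> vector [- v$1, v$2, v$3] \<in> Q"
    and cyc: "\<And>v. v \<in> Q \<Longrightarrow> vector [v$2, v$3, v$1] \<in> Q"
    and norm: "\<And>v. v \<in> Q \<Longrightarrow> (v$1)\<^sup>2 + (v$2)\<^sup>2 + (v$3)\<^sup>2 = \<rho>\<^sup>2"
    and "\<rho> > 0"
  shows "isotropic_about 0 Q \<rho>"
proof -
  define s :: "real^3 \<Rightarrow> real^3" where "s = (\<lambda>v. vector [- v$1, v$2, v$3])"
  define t :: "real^3 \<Rightarrow> real^3" where "t = (\<lambda>v. vector [v$2, v$3, v$1])"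
  have s_comp [simp]: "s v $ 1 = - v$1" "s v $ 2 = v$2" "s v $ 3 = v$3" for v
    by (simp_all add: s_def)
  have t_comp [simp]: "t v $ 1 = v$2" "t v $ 2 = v$3" "t v $ 3 = v$1" for v
    by (simp_all add: t_def)
  have s_s [simp]: "s (s v) = v" and t_t_t [simp]: "t (t (t v)) = v" for v
    by (simp_all add: vec_eq_iff forall_3)
  have sQ: "s v \<in> Q" and tQ: "t v \<in> Q" if "v \<in> Q" for v
    using refl[OF that] cyc[OF that] by (simp_all add: s_def t_def)
  have sum_s: "(\<Sum>v\<in>Q. h v) = (\<Sum>v\<in>Q. h (s v))" for h :: "real^3 \<Rightarrow> real"
    by (rule sum.reindex_bij_witness[where i = s and j = s]) (auto simp: sQ)
  \<comment> \<open>The shift has order three, so its inverse is \<open>t \<circ> t\<close>.\<close>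
  have sum_t: "(\<Sum>v\<in>Q. h v) = (\<Sum>v\<in>Q. h (t v))" for h :: "real^3 \<Rightarrow> real"
    by (rule sum.reindex_bij_witness[where i = t and j = "t \<circ> t"]) (auto simp: tQ)
  have off1: "(\<Sum>v\<in>Q. v$1 * v$2) = 0"
    using sum_s[of "\<lambda>v. v$1 * v$2"] by (simp add: sum_negf)
  have off2: "(\<Sum>v\<in>Q. v$2 * v$3) = 0" and off3: "(\<Sum>v\<in>Q. v$3 * v$1) = 0"
    using off1 sum_t[of "\<lambda>v. v$1 * v$2"] sum_t[of "\<lambda>v. v$2 * v$3"] by simp_all
  define k where "k = (\<Sum>v\<in>Q. (v$1)\<^sup>2)"
  have diag: "(\<Sum>v\<in>Q. (v$2)\<^sup>2) = k" "(\<Sum>v\<in>Q. (v$3)\<^sup>2) = k"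
    using sum_t[of "\<lambda>v. (v$1)\<^sup>2"] sum_t[of "\<lambda>v. (v$2)\<^sup>2"] by (simp_all add: k_def)
  have "(\<Sum>v\<in>Q. (x \<bullet> (v - 0))\<^sup>2) = k * (x \<bullet> x)" for x
  proof -
    have "(\<Sum>v\<in>Q. (x \<bullet> (v - 0))\<^sup>2) =
        (\<Sum>v\<in>Q. (x$1)\<^sup>2 * (v$1)\<^sup>2 + (x$2)\<^sup>2 * (v$2)\<^sup>2 + (x$3)\<^sup>2 * (v$3)\<^sup>2
          + 2 * x$1 * x$2 * (v$1 * v$2) + 2 * x$2 * x$3 * (v$2 * v$3) + 2 * x$3 * x$1 * (v$3 * v$1))"
      by (rule sum.cong) (auto simp: inner_vec_def sum_3 power2_eq_square algebra_simps)
    also have "\<dots> = ((x$1)\<^sup>2 + (x$2)\<^sup>2 + (x$3)\<^sup>2) * k"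
      by (simp add: sum.distrib off1 off2 off3 diag k_def[symmetric] distrib_right
          flip: sum_distrib_left)
    finally show ?thesis
      by (simp add: inner_vec_def sum_3 power2_eq_square)
  qed
  moreover have "2 *\<^sub>R 0 - v \<in> Q" if "v \<in> Q" for v
  proof -
    \<comment> \<open>Each round of shift and reflection negates one coordinate; after three rounds
      all are negated and back in place.\<close>
    have "2 *\<^sub>R 0 - v = s (t (s (t (s (t v)))))"
      by (simp add: vec_eq_iff forall_3)
    then show ?thesis
      using that by (simp add: sQ tQ)
  qed
  moreover have "dist 0 v = \<rho>" if "v \<in> Q" for v
    using norm[OF that] \<open>\<rho> > 0\<close> by (simp add: norm_eq_square inner_vec_def sum_3 power2_eq_square)
  ultimately show ?thesis
    using fin unfolding isotropic_about_def by blast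
qed

section \<open>The model vertex sets of the four solids\<close>

lemma golden_ratio_gt_1: "golden_ratio > 1"
  by (simp add: golden_ratio_def)

lemma golden_ratio_square: "golden_ratio\<^sup>2 = golden_ratio + 1"
  by (simp add: golden_ratio_def power2_eq_square field_simps)

lemma golden_ratio_inverse: "1 / golden_ratio = golden_ratio - 1"
  using golden_ratio_square golden_ratio_gt_1 by (simp add: field_simps power2_eq_square)

lemma octahedron_points_explicit:
  "octahedron_points = {vector [1,0,0], vector [-1,0,0], vector [0,1,0], vector [0,-1,0],
     vector [0,0,1], vector [0,0,-1]}"
  by (auto simp: octahedron_points_def)

lemma cube_points_explicit:
  "cube_points = (\<lambda>(s, t, u). vector [s, t, u]) ` ({-1, 1} \<times> {-1, 1} \<times> {-1, 1})"
  by (auto simp: cube_points_def)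

text \<open>As the image of a finite product, such a set is visibly finite, and membership splits
  into four sign cases.\<close>

lemma signed_pairs_image:
  "{F s t | s t. s \<in> {-1, 1::real} \<and> t \<in> {-1, 1::real}} = (\<lambda>(s, t). F s t) ` ({-1, 1} \<times> {-1, 1})"
  by auto

text \<open>Conditions on absolute values make the invariance under reflections and cyclic shifts
  evident; the icosahedron and the dodecahedron are described in the same form.\<close>

lemma mem_cube_points: "v \<in> cube_points \<longleftrightarrow> \<bar>v$1\<bar> = 1 \<and> \<bar>v$2\<bar> = 1 \<and> \<bar>v$3\<bar> = 1"
  by (auto simp: cube_points_def vec_eq_iff forall_3 abs_if split: if_splits)

lemma mem_icosahedron_points:
  "v \<in> icosahedron_points \<longleftrightarrow>
     v$1 = 0 \<and> \<bar>v$2\<bar> = 1 \<and> \<bar>v$3\<bar> = golden_ratio \<or>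
     v$3 = 0 \<and> \<bar>v$1\<bar> = 1 \<and> \<bar>v$2\<bar> = golden_ratio \<or>
     v$2 = 0 \<and> \<bar>v$3\<bar> = 1 \<and> \<bar>v$1\<bar> = golden_ratio"
  unfolding icosahedron_points_def signed_pairs_image
  using golden_ratio_gt_1 by (auto simp: vec_eq_iff forall_3 abs_if split: if_splits)

lemma mem_dodecahedron_points:
  "v \<in> dodecahedron_points \<longleftrightarrow>
     \<bar>v$1\<bar> = 1 \<and> \<bar>v$2\<bar> = 1 \<and> \<bar>v$3\<bar> = 1 \<or>
     v$1 = 0 \<and> \<bar>v$2\<bar> = 1 / golden_ratio \<and> \<bar>v$3\<bar> = golden_ratio \<or>
     v$3 = 0 \<and> \<bar>v$1\<bar> = 1 / golden_ratio \<and> \<bar>v$2\<bar> = golden_ratio \<or>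
     v$2 = 0 \<and> \<bar>v$3\<bar> = 1 / golden_ratio \<and> \<bar>v$1\<bar> = golden_ratio"
  unfolding dodecahedron_points_def signed_pairs_image Un_iff mem_cube_points
  using golden_ratio_gt_1
  by (auto simp: vec_eq_iff forall_3 abs_if minus_equation_iff[of _ "1 / golden_ratio"] split: if_splits)

lemma isotropic_octahedron: "isotropic_about 0 octahedron_points 1"
  by (rule isotropic_if_coordinate_symmetric) (auto simp: octahedron_points_explicit)

lemma isotropic_cube: "isotropic_about 0 cube_points (sqrt 3)"
proof (rule isotropic_if_coordinate_symmetric)
  show "finite cube_points"
    by (simp add: cube_points_explicit)
  show "(v$1)\<^sup>2 + (v$2)\<^sup>2 + (v$3)\<^sup>2 = (sqrt 3)\<^sup>2" if "v \<in> cube_points" for v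
    using that
    \<comment> \<open>Membership only fixes absolute values, so the squares are rewritten as squares
      of these.\<close>
    unfolding mem_cube_points power2_abs[of "v$1", symmetric]
      power2_abs[of "v$2", symmetric] power2_abs[of "v$3", symmetric]
    by simp
qed (auto simp: mem_cube_points)

lemma isotropic_icosahedron: "isotropic_about 0 icosahedron_points (sqrt (1 + golden_ratio\<^sup>2))"
proof (rule isotropic_if_coordinate_symmetric)
  show "finite icosahedron_points"
    unfolding icosahedron_points_def signed_pairs_image by simp
  show "(v$1)\<^sup>2 + (v$2)\<^sup>2 + (v$3)\<^sup>2 = (sqrt (1 + golden_ratio\<^sup>2))\<^sup>2"
    if "v \<in> icosahedron_points" for v
    using that
    unfolding mem_icosahedron_points power2_abs[of "v$1", symmetric]
      power2_abs[of "v$2", symmetric] power2_abs[of "v$3", symmetric]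
    by (elim disjE conjE) simp_all
  show "sqrt (1 + golden_ratio\<^sup>2) > 0"
    by (simp add: add_pos_nonneg)
qed (auto simp: mem_icosahedron_points)

lemma isotropic_dodecahedron: "isotropic_about 0 dodecahedron_points (sqrt 3)"
proof (rule isotropic_if_coordinate_symmetric)
  show "finite dodecahedron_points"
    unfolding dodecahedron_points_def cube_points_explicit signed_pairs_image by simp
  \<comment> \<open>This puts the twelve additional vertices on the circumsphere of the
    cube.\<close>
  have "(1 / golden_ratio)\<^sup>2 + golden_ratio\<^sup>2 = 3"
    using golden_ratio_square by (simp add: golden_ratio_inverse power2_eq_square algebra_simps)
  then show "(v$1)\<^sup>2 + (v$2)\<^sup>2 + (v$3)\<^sup>2 = (sqrt 3)\<^sup>2" if "v \<in> dodecahedron_points" for v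
    using that
    unfolding mem_dodecahedron_points power2_abs[of "v$1", symmetric]
      power2_abs[of "v$2", symmetric] power2_abs[of "v$3", symmetric]
    by (elim disjE conjE) (simp_all add: add.commute)
qed (auto simp: mem_dodecahedron_points)

text \<open>The tetrahedron is not centrally symmetric and has to be excluded; counting vertices
  does this, and an upper bound is enough.\<close>

lemma card_vertices_regular_tetrahedron:
  assumes "regular_tetrahedron P"
  shows "card (vertices P) \<le> 4"
proof -
  obtain a r g where "P = convex hull ((\<lambda>x. a + r *\<^sub>R g x) ` tetrahedron_points)"
    using assms similar_convex_hull unfolding regular_tetrahedron_def by blast
  then have "vertices P \<subseteq> (\<lambda>x. a + r *\<^sub>R g x) ` tetrahedron_points"
    using vertices_convex_hull_subset by simp
  moreover have "finite tetrahedron_points"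
    by (simp add: tetrahedron_points_def)
  ultimately have "card (vertices P) \<le> card tetrahedron_points"
    by (meson surj_card_le)
  also have "\<dots> \<le> 4"
    by (simp add: tetrahedron_points_def card_insert_if)
  finally show ?thesis .
qed

lemma isotropic_vertices_platonic_solid:
  assumes "platonic_solid P" and "card (vertices P) > 4"
  obtains c \<rho> where "isotropic_about c (vertices P) \<rho>" "\<rho> > 0"
proof -
  have "\<not> regular_tetrahedron P"
    using card_vertices_regular_tetrahedron[of P] assms(2) by linarith
  then have "\<exists>Q \<rho>. similar_sets P (convex hull Q) \<and> isotropic_about 0 Q \<rho> \<and> \<rho> > 0"
    using assms(1) isotropic_octahedron isotropic_cube isotropic_icosahedron isotropic_dodecahedron
    unfolding platonic_solid_def regular_octahedron_def cube_def regular_icosahedron_def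
      regular_dodecahedron_def
    by (metis add_pos_nonneg real_sqrt_gt_zero zero_le_power2 zero_less_numeral zero_less_one)
  then show ?thesis
    using isotropic_vertices_of_similar that by blast
qed

section \<open>Power sums of the distances and the two identities\<close>

text \<open>Expand the powers of \<open>X - 2 * p v\<close> and sum over \<open>V\<close>. Since
  \<open>X - R\<^sup>2\<close> is the squared distance from \<open>M\<close> to the centre, the
  position of \<open>M\<close> enters only through \<open>X\<close>.\<close>

lemma isotropic_distance_sums:
  fixes V :: "(real^3) set" and M :: "real^3"
  assumes iso: "isotropic_about c V R"
  defines "X \<equiv> (dist M c)\<^sup>2 + R\<^sup>2" and "N \<equiv> real (card V)"
  shows "(\<Sum>v\<in>V. dist M v ^ 2) = N * X"
    and "(\<Sum>v\<in>V. dist M v ^ 4) = N * (X\<^sup>2 + 4 / 3 * R\<^sup>2 * (X - R\<^sup>2))"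
    and "(\<Sum>v\<in>V. dist M v ^ 6) = N * (X ^ 3 + 4 * R\<^sup>2 * (X - R\<^sup>2) * X)"
proof -
  define p where "p = (\<lambda>v. (M - c) \<bullet> (v - c))"
  have p1: "(\<Sum>v\<in>V. p v) = 0" and p3: "(\<Sum>v\<in>V. p v ^ 3) = 0"
    using isotropic_sum_odd[OF iso, of 1 "M - c"] isotropic_sum_odd[OF iso, of 3 "M - c"]
    by (simp_all add: p_def)
  \<comment> \<open>The divisor 3 is the dimension of the space.\<close>
  have p2: "(\<Sum>v\<in>V. p v ^ 2) = N * R\<^sup>2 / 3 * (X - R\<^sup>2)"
    using isotropic_sum_squares[OF iso, of "M - c"]
    by (simp add: p_def N_def X_def dist_norm power2_norm_eq_inner)
  have d2: "dist M v ^ 2 = X - 2 * p v" if "v \<in> V" for v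
  proof -
    have "R\<^sup>2 = (v - c) \<bullet> (v - c)"
      using iso that unfolding isotropic_about_def
      by (metis dist_commute dist_norm power2_norm_eq_inner)
    then show ?thesis
      by (simp add: X_def p_def dist_norm power2_norm_eq_inner inner_simps inner_commute)
  qed
  have d4: "dist M v ^ 4 = X\<^sup>2 - 4 * X * p v + 4 * p v ^ 2" if "v \<in> V" for v
  proof -
    have "dist M v ^ 4 = (dist M v ^ 2) ^ 2"
      by simp
    also have "\<dots> = X\<^sup>2 - 4 * X * p v + 4 * p v ^ 2"
      unfolding d2[OF that] by (simp add: power2_eq_square algebra_simps)
    finally show ?thesis .
  qed
  have d6: "dist M v ^ 6 = X ^ 3 - 6 * X\<^sup>2 * p v + 12 * X * p v ^ 2 - 8 * p v ^ 3" if "v \<in> V" for v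
  proof -
    have "dist M v ^ 6 = (dist M v ^ 2) ^ 3"
      by simp
    also have "\<dots> = X ^ 3 - 6 * X\<^sup>2 * p v + 12 * X * p v ^ 2 - 8 * p v ^ 3"
      unfolding d2[OF that] by (simp add: power2_eq_square power3_eq_cube algebra_simps)
    finally show ?thesis .
  qed
  show "(\<Sum>v\<in>V. dist M v ^ 2) = N * X"
    by (simp add: d2 sum_subtractf p1 N_def flip: sum_distrib_left)
  show "(\<Sum>v\<in>V. dist M v ^ 4) = N * (X\<^sup>2 + 4 / 3 * R\<^sup>2 * (X - R\<^sup>2))"
    by (simp add: d4 sum_subtractf sum.distrib p1 p2 flip: sum_distrib_left)
      (simp add: N_def field_simps)
  have "(\<Sum>v\<in>V. dist M v ^ 6) = N * X ^ 3 + 12 * X * (\<Sum>v\<in>V. p v ^ 2)"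
    by (simp add: d6 sum_subtractf sum.distrib p1 p3 N_def flip: sum_distrib_left)
  also have "12 * X * (\<Sum>v\<in>V. p v ^ 2) = N * (4 * R\<^sup>2 * (X - R\<^sup>2) * X)"
    unfolding p2 by simp
  finally show "(\<Sum>v\<in>V. dist M v ^ 6) = N * (X ^ 3 + 4 * R\<^sup>2 * (X - R\<^sup>2) * X)"
    by (simp add: distrib_left)
qed

theorem theorem7p3:
  fixes P :: "(real^3) set" and A :: "nat \<Rightarrow> real^3" and n :: nat
    and R :: real and M :: "real^3"
  assumes "platonic_solid P"
    and "n \<in> {6, 8, 12, 20}"
    and "bij_betw A {1..n} (vertices P)"
    and "R > 0"
    and "has_circumradius P R"
  shows "S n A 6 M = S n A 2 M * ((S n A 2 M + 2 * R^2)^2 - 8 * R^4)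
       \<and> S n A 6 M = S n A 2 M * (3 * S n A 4 M - 2 * (S n A 2 M)^2)"
proof -
  have card: "card (vertices P) = n" and "n > 4"
    using bij_betw_same_card[OF assms(3)] assms(2) by auto
  obtain c \<rho> where iso: "isotropic_about c (vertices P) \<rho>" and "\<rho> > 0"
    using isotropic_vertices_platonic_solid[OF assms(1)] card \<open>n > 4\<close> by blast
  have "vertices P \<noteq> {}"
    using card \<open>n > 4\<close> by auto
  moreover obtain a where "\<And>v. v \<in> vertices P \<Longrightarrow> dist a v = R"
    using assms(5) unfolding has_circumradius_def by blast
  \<comment> \<open>The given circumradius belongs to some centre \<open>a\<close>; uniqueness makes
    it \<open>c\<close>, and any vertex then compares the radii.\<close>
  ultimately have "\<rho> = R"
    using isotropic_circumcentre_unique[OF iso _ \<open>\<rho> > 0\<close>, of a R] iso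
    unfolding isotropic_about_def by (metis all_not_in_conv)
  define X where "X = (dist M c)\<^sup>2 + R\<^sup>2"
  have S_eq: "S n A k M = (\<Sum>v\<in>vertices P. dist M v ^ k) / n" for k
    using sum.reindex_bij_betw[OF assms(3), of "\<lambda>v. dist M v ^ k"] by (simp add: S_def)
  have S: "S n A 2 M = X" "S n A 4 M = X\<^sup>2 + 4 / 3 * R\<^sup>2 * (X - R\<^sup>2)"
    "S n A 6 M = X ^ 3 + 4 * R\<^sup>2 * (X - R\<^sup>2) * X"
    using isotropic_distance_sums[OF iso, of M] \<open>n > 4\<close>
    by (simp_all add: S_eq card X_def \<open>\<rho> = R\<close>)
  \<comment> \<open>Both factors multiplying \<open>S n A 2 M\<close> on the right reduce to
    \<open>X\<^sup>2 + 4 * R\<^sup>2 * (X - R\<^sup>2)\<close>.\<close>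
  show ?thesis
    unfolding S by (simp add: field_simps power2_eq_square power3_eq_cube power4_eq_xxxx)
qed

end
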